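(* If $L$ is a cyclically transitive linear order and $\overline{L}$ is a discrete, unbounded, cyclically transitive linear order, then $L\cdot\overline{L}$ is unbounded and cyclically transitive. Hence, the class of discrete unbounded cyclically transitive linear orders is closed under products: if $L$ and $\overline{L}$ are both discrete, unbounded and cyclically transitive, then so is $L\cdot\overline{L}$.
   Context: Linear orders may be empty. $L_1+L_2$ denotes the ordered sum (every element of $L_1$ strictly below every element of $L_2$); a partition $L=L_1+L_2$ means that $L_1$ is an initial segment of $L$ and $L_2$ is its complement (either may be empty). The product $L_1\cdot L_2$ is $L_1\times L_2$ with the colexicographic order (the second coordinate takes precedence over the first). $L$ is cyclically transitive if for any $a\le b$ in $L$ there exist partitions $L=L_1+L_2=L_2'+L_1'$ with $a\in L_1$, $b\in L_1'$, and order isomorphisms $F_1:L_1\to L_1'$, $F_2:L_2\to L_2'$ satisfying $F_1(a)=b$. $L$ is unbounded if for each $a\in L$ there are $b,c\in L$ with $b<a<c$. It is discrete if every non-greatest element has an immediate successor and every non-least element has an immediate predecessor. *)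

theory Defs
  imports Main
begin

text \<open>
  A linear order, possibly empty, is a reflexive relation \<open>r\<close> with \<open>Linear_order r\<close>; its underlying
  set is \<open>Field r\<close>. The strict order is \<open>r - Id\<close>.
\<close>

text \<open>Colexicographic product: the second coordinate takes precedence.\<close>

definition colex_prod :: "'a rel \<Rightarrow> 'b rel \<Rightarrow> ('a \<times> 'b) rel" where
  "colex_prod r s =
     {((a, b), (a', b')).
        a \<in> Field r \<and> a' \<in> Field r \<and> b \<in> Field s \<and> b' \<in> Field s \<and>
        ((b, b') \<in> s - Id \<or> b = b' \<and> (a, a') \<in> r)}"

lemma Field_colex_prod:
  assumes "Refl r" and "Refl s"
  shows "Field (colex_prod r s) = Field r \<times> Field s"
proof
  show "Field (colex_prod r s) \<subseteq> Field r \<times> Field s"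
    by (auto simp: colex_prod_def Field_def)
  show "Field r \<times> Field s \<subseteq> Field (colex_prod r s)"
  proof
    fix x assume "x \<in> Field r \<times> Field s"
    then have "(x, x) \<in> colex_prod r s"
      using assms by (auto simp: colex_prod_def refl_on_def)
    then show "x \<in> Field (colex_prod r s)"
      by (rule FieldI1)
  qed
qed

text \<open>
  The partition \<open>L = A + B\<close> of a linear order. In the library, \<open>ofilter r A\<close> says that \<open>A\<close> is a
  downward closed subset of \<open>Field r\<close>, i.e. an initial segment; \<open>A\<close> and \<open>B\<close> may be empty.
\<close>

definition ord_partition :: "'a rel \<Rightarrow> 'a set \<Rightarrow> 'a set \<Rightarrow> bool" where
  "ord_partition r A B \<longleftrightarrow> ofilter r A \<and> B = Field r - A"

text \<open>
  The library's \<open>iso\<close> is developed with well-orders in mind, but by \<open>iso_iff2\<close> it is the notion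
  of isomorphism for arbitrary relations.
\<close>

definition cyclically_transitive :: "'a rel \<Rightarrow> bool" where
  "cyclically_transitive r \<longleftrightarrow>
     (\<forall>a b. (a, b) \<in> r \<longrightarrow>
        (\<exists>L1 L2 L1' L2' F1 F2.
           ord_partition r L1 L2 \<and> ord_partition r L2' L1' \<and>
           a \<in> L1 \<and> b \<in> L1' \<and>
           iso (Restr r L1) (Restr r L1') F1 \<and>
           iso (Restr r L2) (Restr r L2') F2 \<and>
           F1 a = b))"

definition unbounded_order :: "'a rel \<Rightarrow> bool" where
  "unbounded_order r \<longleftrightarrow> (\<forall>a\<in>Field r. \<exists>b c. (b, a) \<in> r - Id \<and> (a, c) \<in> r - Id)"

definition immediate_succ :: "'a rel \<Rightarrow> 'a \<Rightarrow> 'a \<Rightarrow> bool" where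
  "immediate_succ r a b \<longleftrightarrow>
     (a, b) \<in> r - Id \<and> \<not> (\<exists>c. (a, c) \<in> r - Id \<and> (c, b) \<in> r - Id)"

definition discrete_order :: "'a rel \<Rightarrow> bool" where
  "discrete_order r \<longleftrightarrow>
     (\<forall>a\<in>Field r. \<not> (\<forall>x\<in>Field r. (x, a) \<in> r) \<longrightarrow> (\<exists>b. immediate_succ r a b)) \<and>
     (\<forall>a\<in>Field r. \<not> (\<forall>x\<in>Field r. (a, x) \<in> r) \<longrightarrow> (\<exists>b. immediate_succ r b a))"

end

theory Submission
  imports Defs
begin

text \<open>
  If \<open>F1 : L1 \<rightarrow> L1'\<close> and \<open>F2 : L2 \<rightarrow> L2'\<close> witness cyclic transitivity of \<open>L\<close> at \<open>a \<le> a'\<close>, then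
  applying \<open>F1\<close> within each copy of \<open>L\<close> and sending \<open>L2\<close> via \<open>F2\<close> into the next copy defines an
  automorphism of the product which maps \<open>(a, m)\<close> to \<open>(a', m)\<close> for every \<open>m\<close>. Given
  \<open>(a, b) \<le> (a', b')\<close>, lift a witness for \<open>b \<le> b'\<close> to the product, so that \<open>(a, b)\<close> goes to
  \<open>(a, b')\<close>, and compose it with this automorphism, or with an inverse of one if \<open>a' < a\<close>.
\<close>

section \<open>Linear orders and their colexicographic products\<close>

lemma Linear_order_antisymD: "Linear_order r \<Longrightarrow> (x, y) \<in> r \<Longrightarrow> (y, x) \<in> r \<Longrightarrow> x = y"
  unfolding order_on_defs antisym_def by blast

lemma Linear_order_transD: "Linear_order r \<Longrightarrow> (x, y) \<in> r \<Longrightarrow> (y, z) \<in> r \<Longrightarrow> (x, z) \<in> r"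
  unfolding order_on_defs trans_def by blast

lemma Linear_order_reflD: "Linear_order r \<Longrightarrow> x \<in> Field r \<Longrightarrow> (x, x) \<in> r"
  unfolding order_on_defs refl_on_def by blast

lemma Linear_order_totalD:
  "Linear_order r \<Longrightarrow> x \<in> Field r \<Longrightarrow> y \<in> Field r \<Longrightarrow> (x, y) \<in> r \<or> (y, x) \<in> r"
  unfolding order_on_defs refl_on_def total_on_def by metis

lemma Field_colex_prod_Linear_order:
  "Linear_order r \<Longrightarrow> Linear_order s \<Longrightarrow> Field (colex_prod r s) = Field r \<times> Field s"
  by (rule Field_colex_prod) (auto simp: order_on_defs)

lemma Linear_order_colex_prod:
  assumes r: "Linear_order r" and s: "Linear_order s"
  shows "Linear_order (colex_prod r s)"
proof -
  have "Refl (colex_prod r s)"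
    using Linear_order_reflD[OF r]
    by (auto simp: refl_on_def Field_colex_prod_Linear_order[OF r s]) (auto simp: colex_prod_def)
  moreover have "trans (colex_prod r s)"
    using Linear_order_transD[OF r] Linear_order_transD[OF s] Linear_order_antisymD[OF s]
    unfolding trans_def colex_prod_def by auto
  moreover have "antisym (colex_prod r s)"
    using Linear_order_antisymD[OF r] Linear_order_antisymD[OF s]
    by (auto simp: antisym_def colex_prod_def)
  moreover have "Total (colex_prod r s)"
    using Linear_order_totalD[OF r] Linear_order_totalD[OF s]
    unfolding total_on_def Field_colex_prod_Linear_order[OF r s] by (auto simp: colex_prod_def)
  ultimately show ?thesis
    by (auto simp: order_on_defs intro: FieldI1 FieldI2)
qed

section \<open>Isomorphisms and partitions of linear orders\<close>

lemma Linear_order_isoI: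
  assumes r: "Linear_order r" and s: "Linear_order s"
    and im: "f ` Field r = Field s"
    and mono: "\<And>x y. (x, y) \<in> r \<Longrightarrow> x \<noteq> y \<Longrightarrow> (f x, f y) \<in> s \<and> f x \<noteq> f y"
  shows "iso r s f"
proof -
  \<comment> \<open>Distinct points are comparable by totality, so strict monotonicity separates
    their images.\<close>
  have "inj_on f (Field r)"
    unfolding inj_on_def using mono Linear_order_totalD[OF r] by metis
  moreover have "(x, y) \<in> r \<longleftrightarrow> (f x, f y) \<in> s" if "x \<in> Field r" "y \<in> Field r" for x y
  proof
    show "(f x, f y) \<in> s" if "(x, y) \<in> r"
      using that mono[of x y] Linear_order_reflD[OF s, of "f x"] im \<open>x \<in> Field r\<close> by (cases "x = y") auto
    \<comment> \<open>Otherwise \<open>y\<close> is strictly below \<open>x\<close>, and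
      \<open>mono\<close> would put \<open>f y\<close> strictly below \<open>f x\<close>.\<close>
    show "(x, y) \<in> r" if "(f x, f y) \<in> s"
      using that Linear_order_totalD[OF r \<open>x \<in> Field r\<close> \<open>y \<in> Field r\<close>] mono[of y x]
        Linear_order_antisymD[OF s] by metis
  qed
  ultimately show ?thesis
    using im by (auto simp: iso_iff2 bij_betw_def)
qed

lemma iso_inv_into_Field:
  assumes "iso r s f"
  shows "iso s r (inv_into (Field r) f)"
proof -
  have f: "bij_betw f (Field r) (Field s)"
    and mono: "\<And>x y. x \<in> Field r \<Longrightarrow> y \<in> Field r \<Longrightarrow> (x, y) \<in> r \<longleftrightarrow> (f x, f y) \<in> s"
    using assms by (auto simp: iso_iff2)
  let ?g = "inv_into (Field r) f"
  have g: "bij_betw ?g (Field s) (Field r)"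
    by (rule bij_betw_inv_into[OF f])
  moreover have "(x, y) \<in> s \<longleftrightarrow> (?g x, ?g y) \<in> r" if "x \<in> Field s" "y \<in> Field s" for x y
    using mono[of "?g x" "?g y"] that bij_betw_inv_into_right[OF f] bij_betwE[OF g] by auto
  ultimately show ?thesis
    by (auto simp: iso_iff2)
qed

lemma ord_partitionD:
  assumes "ord_partition r A B"
  shows "A \<subseteq> Field r" "B \<subseteq> Field r" "A \<union> B = Field r" "A \<inter> B = {}"
    and "\<And>x y. y \<in> A \<Longrightarrow> (x, y) \<in> r \<Longrightarrow> x \<in> A"
  using assms by (auto simp: ord_partition_def ofilter_def under_def)

lemma ord_partitionI:
  assumes "A \<union> B = Field r" "A \<inter> B = {}" "\<And>x y. y \<in> A \<Longrightarrow> (x, y) \<in> r \<Longrightarrow> x \<in> A"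
  shows "ord_partition r A B"
  using assms by (auto simp: ord_partition_def ofilter_def under_def)

text \<open>By totality the alternative is \<open>(y, x) \<in> r\<close>, and downward closure would
  then force \<open>y\<close> into \<open>A\<close>.\<close>

lemma ord_partition_less:
  assumes "Linear_order r" "ord_partition r A B" "x \<in> A" "y \<in> B"
  shows "(x, y) \<in> r \<and> x \<noteq> y"
  using assms ord_partitionD[OF assms(2)] Linear_order_totalD[OF assms(1), of x y] by blast

text \<open>Reflexivity guarantees that no point of \<open>A\<close> or \<open>B\<close> is lost on
  restriction, so the fields of the restricted relations are exactly \<open>A\<close> and
  \<open>B\<close>.\<close>

lemma iso_Restr_iff:
  assumes "Linear_order r" "Linear_order s" "A \<subseteq> Field r" "B \<subseteq> Field s"
  shows "iso (Restr r A) (Restr s B) f \<longleftrightarrow>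
    bij_betw f A B \<and> (\<forall>x\<in>A. \<forall>y\<in>A. (x, y) \<in> r \<longleftrightarrow> (f x, f y) \<in> s)"
proof -
  have "Field (Restr r A) = A" "Field (Restr s B) = B"
    using assms by (auto simp: order_on_defs intro!: Refl_Field_Restr2)
  then show ?thesis
    by (auto simp: iso_iff2 dest: bij_betwE)
qed

section \<open>Cyclic shifts: the condition for a single pair of points\<close>

definition cyclic_shift :: "'a rel \<Rightarrow> 'a \<Rightarrow> 'a \<Rightarrow> bool" where
  "cyclic_shift r a b \<longleftrightarrow>
     (\<exists>L1 L2 L1' L2' F1 F2.
        ord_partition r L1 L2 \<and> ord_partition r L2' L1' \<and>
        a \<in> L1 \<and> b \<in> L1' \<and>
        iso (Restr r L1) (Restr r L1') F1 \<and>
        iso (Restr r L2) (Restr r L2') F2 \<and>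
        F1 a = b)"

lemma cyclically_transitive_iff:
  "cyclically_transitive r \<longleftrightarrow> (\<forall>a b. (a, b) \<in> r \<longrightarrow> cyclic_shift r a b)"
  by (simp add: cyclically_transitive_def cyclic_shift_def)

text \<open>Trades isomorphisms of restricted relations for bijections with order equivalences, so
  that witnesses can be composed and lifted without mentioning \<open>Restr\<close>;
  \<open>cyclic_shiftI\<close> goes the other way.\<close>

lemma cyclic_shiftE:
  assumes r: "Linear_order r" and "cyclic_shift r a b"
  obtains L1 L2 L1' L2' F1 F2 where
    "ord_partition r L1 L2" "ord_partition r L2' L1'" "a \<in> L1" "F1 a = b"
    "bij_betw F1 L1 L1'" "bij_betw F2 L2 L2'"
    "\<And>x y. x \<in> L1 \<Longrightarrow> y \<in> L1 \<Longrightarrow> (x, y) \<in> r \<longleftrightarrow> (F1 x, F1 y) \<in> r"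
    "\<And>x y. x \<in> L2 \<Longrightarrow> y \<in> L2 \<Longrightarrow> (x, y) \<in> r \<longleftrightarrow> (F2 x, F2 y) \<in> r"
proof -
  obtain L1 L2 L1' L2' F1 F2 where *:
    "ord_partition r L1 L2" "ord_partition r L2' L1'" "a \<in> L1" "F1 a = b"
    "iso (Restr r L1) (Restr r L1') F1" "iso (Restr r L2) (Restr r L2') F2"
    using assms(2) unfolding cyclic_shift_def by blast
  then show thesis
    using that[of L1 L2 L2' L1' F1 F2]
      iso_Restr_iff[OF r r ord_partitionD(1)[OF *(1)] ord_partitionD(2)[OF *(2)]]
      iso_Restr_iff[OF r r ord_partitionD(2)[OF *(1)] ord_partitionD(1)[OF *(2)]]
    by auto
qed

lemma cyclic_shiftI:
  assumes r: "Linear_order r"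
    and "ord_partition r L1 L2" "ord_partition r L2' L1'" "a \<in> L1" "F1 a = b"
    and "bij_betw F1 L1 L1'" "bij_betw F2 L2 L2'"
    and "\<And>x y. x \<in> L1 \<Longrightarrow> y \<in> L1 \<Longrightarrow> (x, y) \<in> r \<longleftrightarrow> (F1 x, F1 y) \<in> r"
    and "\<And>x y. x \<in> L2 \<Longrightarrow> y \<in> L2 \<Longrightarrow> (x, y) \<in> r \<longleftrightarrow> (F2 x, F2 y) \<in> r"
  shows "cyclic_shift r a b"
proof -
  have "iso (Restr r L1) (Restr r L1') F1" "iso (Restr r L2) (Restr r L2') F2"
    using assms ord_partitionD(1,2)[OF assms(2)] ord_partitionD(1,2)[OF assms(3)]
    by (simp_all add: iso_Restr_iff)
  moreover have "b \<in> L1'"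
    using assms(4-6) bij_betwE by fast
  ultimately show ?thesis
    unfolding cyclic_shift_def using assms(2-5) by blast
qed

text \<open>Compose both maps of the witness with \<open>g\<close>. The source partition stays, and
  the target partition is replaced by its image, which is again a partition because an automorphism
  carries initial segments to initial segments.\<close>

lemma cyclic_shift_automorphism:
  assumes r: "Linear_order r" and "cyclic_shift r a b" and g: "iso r r g"
  shows "cyclic_shift r a (g b)"
  using r \<open>cyclic_shift r a b\<close>
proof (rule cyclic_shiftE)
  fix L1 L2 L1' L2' F1 F2
  assume L: "ord_partition r L1 L2" and L': "ord_partition r L2' L1'" and a: "a \<in> L1" "F1 a = b"
    and F: "bij_betw F1 L1 L1'" "bij_betw F2 L2 L2'"
    and m: "\<And>x y. x \<in> L1 \<Longrightarrow> y \<in> L1 \<Longrightarrow> (x, y) \<in> r \<longleftrightarrow> (F1 x, F1 y) \<in> r"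
      "\<And>x y. x \<in> L2 \<Longrightarrow> y \<in> L2 \<Longrightarrow> (x, y) \<in> r \<longleftrightarrow> (F2 x, F2 y) \<in> r"
  note D' = ord_partitionD[OF L']
  have bij: "bij_betw g (Field r) (Field r)"
    and mono: "\<And>x y. x \<in> Field r \<Longrightarrow> y \<in> Field r \<Longrightarrow> (x, y) \<in> r \<longleftrightarrow> (g x, g y) \<in> r"
    using g by (auto simp: iso_iff2)
  have inj: "inj_on g (Field r)" and im: "g ` Field r = Field r"
    using bij by (auto simp: bij_betw_def)
  have part: "ord_partition r (g ` L2') (g ` L1')"
  proof (rule ord_partitionI)
    show "g ` L2' \<union> g ` L1' = Field r"
      using D'(3) im by (metis image_Un)
    show "g ` L2' \<inter> g ` L1' = {}"
      using inj_on_image_Int[OF inj D'(1,2)] D'(4) by simp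
    show "x \<in> g ` L2'" if y: "y \<in> g ` L2'" and xy: "(x, y) \<in> r" for x y
    proof -
      \<comment> \<open>Surjectivity of \<open>g\<close> provides a preimage of \<open>x\<close>; as
        \<open>g\<close> reflects the order, it lies below the preimage of \<open>y\<close>, hence
        in \<open>L2'\<close>.\<close>
      obtain x' y' where "x = g x'" "x' \<in> Field r" "y = g y'" "y' \<in> L2'"
        using y im FieldI1[OF xy] by blast
      then show ?thesis
        using xy mono[of x' y'] D'(1,5) by blast
    qed
  qed
  have "bij_betw (g \<circ> F1) L1 (g ` L1')" "bij_betw (g \<circ> F2) L2 (g ` L2')"
    using F D'(1,2) inj by (auto intro!: bij_betw_trans bij_betw_subset[OF bij])
  then show ?thesis
  proof (rule cyclic_shiftI[OF r L part a(1), rotated])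
    have "F1 x \<in> Field r" if "x \<in> L1" for x
      using that bij_betwE[OF F(1)] D'(2) by blast
    then show "(x, y) \<in> r \<longleftrightarrow> ((g \<circ> F1) x, (g \<circ> F1) y) \<in> r" if "x \<in> L1" "y \<in> L1" for x y
      using that m(1) mono by simp
    have "F2 x \<in> Field r" if "x \<in> L2" for x
      using that bij_betwE[OF F(2)] D'(1) by blast
    then show "(x, y) \<in> r \<longleftrightarrow> ((g \<circ> F2) x, (g \<circ> F2) y) \<in> r" if "x \<in> L2" "y \<in> L2" for x y
      using that m(2) mono by simp
  qed (simp add: a(2))
qed

text \<open>The product is \<open>s\<close> with each point replaced by a copy of \<open>r\<close>.
  A partition of \<open>s\<close> therefore induces one of the product, and the maps of a witness
  for \<open>s\<close> move whole copies, acting as the identity on the first coordinate.\<close>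

lemma cyclic_shift_colex_prod:
  assumes r: "Linear_order r" and s: "Linear_order s"
    and a: "a \<in> Field r" and "cyclic_shift s b b'"
  shows "cyclic_shift (colex_prod r s) (a, b) (a, b')"
  using s \<open>cyclic_shift s b b'\<close>
proof (rule cyclic_shiftE)
  fix M1 M2 M1' M2' G1 G2
  assume M: "ord_partition s M1 M2" and M': "ord_partition s M2' M1'" and b: "b \<in> M1" "G1 b = b'"
    and G: "bij_betw G1 M1 M1'" "bij_betw G2 M2 M2'"
    and m: "\<And>x y. x \<in> M1 \<Longrightarrow> y \<in> M1 \<Longrightarrow> (x, y) \<in> s \<longleftrightarrow> (G1 x, G1 y) \<in> s"
      "\<And>x y. x \<in> M2 \<Longrightarrow> y \<in> M2 \<Longrightarrow> (x, y) \<in> s \<longleftrightarrow> (G2 x, G2 y) \<in> s"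
  have part: "ord_partition (colex_prod r s) (Field r \<times> A) (Field r \<times> B)" if "ord_partition s A B" for A B
  proof (rule ord_partitionI)
    show "Field r \<times> A \<union> Field r \<times> B = Field (colex_prod r s)"
      "(Field r \<times> A) \<inter> (Field r \<times> B) = {}"
      using ord_partitionD(3,4)[OF that] by (auto simp: Field_colex_prod_Linear_order[OF r s])
    show "x \<in> Field r \<times> A" if "y \<in> Field r \<times> A" "(x, y) \<in> colex_prod r s" for x y
      using that ord_partitionD(5)[OF \<open>ord_partition s A B\<close>]
      by (cases x; cases y) (auto simp: colex_prod_def)
  qed
  have bij: "bij_betw (map_prod id f) (Field r \<times> A) (Field r \<times> B)" if "bij_betw f A B" for f A B
    using that by (intro bij_betw_map_prod) auto
  \<comment> \<open>Injectivity of \<open>f\<close> matters here: second coordinates agree before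
    the map iff they agree after it, so both sides are decided by the same clause of the
    colexicographic order.\<close>
  have mono: "(x, y) \<in> colex_prod r s \<longleftrightarrow> (map_prod id f x, map_prod id f y) \<in> colex_prod r s"
    if "x \<in> Field r \<times> A" "y \<in> Field r \<times> A" "A \<subseteq> Field s" "B \<subseteq> Field s" "bij_betw f A B"
      "\<And>x y. x \<in> A \<Longrightarrow> y \<in> A \<Longrightarrow> (x, y) \<in> s \<longleftrightarrow> (f x, f y) \<in> s" for f A B x y
    using that bij_betwE[OF that(5)] inj_on_eq_iff[OF bij_betw_imp_inj_on[OF that(5)]]
    by (auto simp: colex_prod_def)
  note D = ord_partitionD(1,2)[OF M] and D' = ord_partitionD(1,2)[OF M']
  show ?thesis
    by (rule cyclic_shiftI[OF Linear_order_colex_prod[OF r s] part[OF M] part[OF M'] _ _ bij[OF G(1)] bij[OF G(2)]])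
      (use a b in simp, use b in simp, erule (1) mono[OF _ _ D(1) D'(2) G(1) m(1)],
        assumption+, erule (1) mono[OF _ _ D(2) D'(1) G(2) m(2)], assumption+)
qed

section \<open>Immediate successors and the automorphism of the product\<close>

lemma discrete_unbounded_immediate:
  assumes s: "Linear_order s" and "discrete_order s" and "unbounded_order s" and "m \<in> Field s"
  shows "\<exists>n. immediate_succ s m n" "\<exists>n. immediate_succ s n m"
proof -
  obtain b c where "(b, m) \<in> s - Id" "(m, c) \<in> s - Id"
    using assms(3,4) unfolding unbounded_order_def by blast
  \<comment> \<open>The points \<open>b\<close> and \<open>c\<close> show that \<open>m\<close> is
    neither least nor greatest, so both exceptions in \<open>discrete_order\<close> are
    excluded.\<close>
  then have "\<not> (\<forall>x\<in>Field s. (x, m) \<in> s)" "\<not> (\<forall>x\<in>Field s. (m, x) \<in> s)"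
    using Linear_order_antisymD[OF s] FieldI1[of b m s] FieldI2[of m c s] by blast+
  then show "\<exists>n. immediate_succ s m n" "\<exists>n. immediate_succ s n m"
    using assms(2,4) unfolding discrete_order_def by blast+
qed

text \<open>Supplies the passage to the next copy of \<open>r\<close> in the product. Existence of
  immediate predecessors is what makes \<open>S\<close> surjective.\<close>

lemma discrete_unbounded_succ:
  assumes s: "Linear_order s" and "discrete_order s" and "unbounded_order s"
  obtains S where "bij_betw S (Field s) (Field s)"
    "\<And>m. m \<in> Field s \<Longrightarrow> (m, S m) \<in> s \<and> m \<noteq> S m"
    "\<And>m n. (m, n) \<in> s \<Longrightarrow> m \<noteq> n \<Longrightarrow> (S m, n) \<in> s"
proof -
  note discrete_unbounded_immediate[OF assms]
  then obtain S P where S: "\<And>m. m \<in> Field s \<Longrightarrow> immediate_succ s m (S m)"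
    and P: "\<And>m. m \<in> Field s \<Longrightarrow> immediate_succ s (P m) m"
    by metis
  have lt: "(m, S m) \<in> s \<and> m \<noteq> S m" if "m \<in> Field s" for m
    using S[OF that] by (auto simp: immediate_succ_def)
  \<comment> \<open>If this failed, \<open>n\<close> would lie strictly between \<open>m\<close> and
    its immediate successor \<open>S m\<close>.\<close>
  have least: "(S m, n) \<in> s" if "(m, n) \<in> s" "m \<noteq> n" for m n
    using S[of m] that Linear_order_totalD[OF s, of "S m" n] Linear_order_reflD[OF s, of n]
      FieldI1[OF that(1)] FieldI2[OF that(1)] FieldI2[of m "S m" s]
    unfolding immediate_succ_def by blast
  \<comment> \<open>If \<open>m\<close> is strictly below \<open>n\<close>, then \<open>S m\<close>
    \<le> \<open>n\<close>, and \<open>n\<close> is strictly below \<open>S n\<close>.\<close>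
  have "inj_on S (Field s)"
    unfolding inj_on_def
    using lt least Linear_order_totalD[OF s] Linear_order_antisymD[OF s] by metis
  moreover have "S ` Field s = Field s"
  proof
    show "S ` Field s \<subseteq> Field s"
      using lt by (auto intro: FieldI2)
    show "Field s \<subseteq> S ` Field s"
    proof
      fix n assume "n \<in> Field s"
      then have n: "(P n, n) \<in> s" "P n \<noteq> n"
        "\<not> (\<exists>c. (P n, c) \<in> s - Id \<and> (c, n) \<in> s - Id)"
        using P by (auto simp: immediate_succ_def)
      \<comment> \<open>\<open>least\<close> gives \<open>S (P n)\<close> \<le> \<open>n\<close>; if
        they differed, \<open>S (P n)\<close> would lie strictly between \<open>P n\<close> and
        \<open>n\<close>.\<close>
      then have "S (P n) = n"
        using lt[of "P n"] least[OF n(1,2)] FieldI1[OF n(1)] by blast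
      then show "n \<in> S ` Field s"
        using FieldI1[OF n(1)] by force
    qed
  qed
  ultimately show thesis
    using that[of S] lt least by (simp add: bij_betw_def)
qed

text \<open>Each copy of \<open>r\<close> reads as \<open>L1 + L2\<close>, and also as
  \<open>L2' + L1'\<close>. The \<open>L2\<close> part of copy \<open>m\<close> and the
  \<open>L1\<close> part of the next copy \<open>S m\<close> are consecutive in the product, and
  together they are mapped onto copy \<open>S m\<close> in the form \<open>L2' + L1'\<close>. This
  regrouping covers every copy exactly once because \<open>S\<close> is a bijection.\<close>

lemma colex_prod_automorphism:
  assumes r: "Linear_order r" and s: "Linear_order s"
    and "discrete_order s" "unbounded_order s" and "cyclic_shift r a a'"
  obtains g where "iso (colex_prod r s) (colex_prod r s) g"
    "\<And>m. g (a, m) = (a', m)"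
  using r \<open>cyclic_shift r a a'\<close>
proof (rule cyclic_shiftE)
  fix L1 L2 L1' L2' F1 F2
  assume L: "ord_partition r L1 L2" and L': "ord_partition r L2' L1'" and a: "a \<in> L1" "F1 a = a'"
    and F: "bij_betw F1 L1 L1'" "bij_betw F2 L2 L2'"
    and m: "\<And>x y. x \<in> L1 \<Longrightarrow> y \<in> L1 \<Longrightarrow> (x, y) \<in> r \<longleftrightarrow> (F1 x, F1 y) \<in> r"
      "\<And>x y. x \<in> L2 \<Longrightarrow> y \<in> L2 \<Longrightarrow> (x, y) \<in> r \<longleftrightarrow> (F2 x, F2 y) \<in> r"
  note D = ord_partitionD[OF L] and D' = ord_partitionD[OF L']
  obtain S where S: "bij_betw S (Field s) (Field s)"
    and lt: "\<And>m. m \<in> Field s \<Longrightarrow> (m, S m) \<in> s \<and> m \<noteq> S m"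
    and least: "\<And>m n. (m, n) \<in> s \<Longrightarrow> m \<noteq> n \<Longrightarrow> (S m, n) \<in> s"
    using discrete_unbounded_succ[OF s assms(3,4)] by blast
  define g where "g = (\<lambda>(x, m). if x \<in> L1 then (F1 x, m) else (F2 x, S m))"
  have g1: "g (x, m) = (F1 x, m)" if "x \<in> L1" for x m
    using that by (simp add: g_def)
  have g2: "g (x, m) = (F2 x, S m)" if "x \<in> L2" for x m
    using that D(4) by (auto simp: g_def)
  have FL: "F1 x \<in> L1'" if "x \<in> L1" for x
    using that F(1) bij_betwE by fast
  have FL2: "F2 x \<in> L2'" if "x \<in> L2" for x
    using that F(2) bij_betwE by fast
  have SF: "S m \<in> Field s" if "m \<in> Field s" for m
    using that S bij_betwE by fast
  have Fld: "Field r = L1 \<union> L2" "Field r = L2' \<union> L1'"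
    using D(3) D'(3) by auto
  have in_F: "\<And>x. x \<in> L1 \<Longrightarrow> F1 x \<in> Field r" "\<And>x. x \<in> L2 \<Longrightarrow> F2 x \<in> Field r"
    using FL FL2 Fld(2) by auto
  have im: "g ` (Field r \<times> Field s) = Field r \<times> Field s"
  proof
    show "g ` (Field r \<times> Field s) \<subseteq> Field r \<times> Field s"
    proof (rule image_subsetI)
      fix p assume "p \<in> Field r \<times> Field s"
      then show "g p \<in> Field r \<times> Field s"
        using in_F SF D(3) by (cases p) (auto simp: g_def)
    qed
    show "Field r \<times> Field s \<subseteq> g ` (Field r \<times> Field s)"
    proof
      fix p assume "p \<in> Field r \<times> Field s"
      then obtain z n where p: "p = (z, n)" "z \<in> Field r" "n \<in> Field s"
        by blast
      consider "z \<in> L1'" | "z \<in> L2'"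
        using p(2) Fld(2) by blast
      then show "p \<in> g ` (Field r \<times> Field s)"
      proof cases
        case 1
        then obtain x where "x \<in> L1" "z = F1 x"
          using F(1) by (auto simp: bij_betw_def)
        then show ?thesis
          using p g1[of x n] Fld(1) by (intro image_eqI[of _ _ "(x, n)"]) auto
      next
        case 2
        then obtain x where x: "x \<in> L2" "z = F2 x"
          using F(2) by (auto simp: bij_betw_def)
        \<comment> \<open>A point in the \<open>L2'\<close> part of copy \<open>n\<close> comes from
          the preceding copy \<open>k\<close>.\<close>
        obtain k where "k \<in> Field s" "n = S k"
          using p(3) S by (auto simp: bij_betw_def)
        then show ?thesis
          using x p g2[of x k] Fld(1) by (intro image_eqI[of _ _ "(x, k)"]) auto
      qed
    qed
  qed
  have mono: "(g p, g q) \<in> colex_prod r s \<and> g p \<noteq> g q" if less: "(p, q) \<in> colex_prod r s" "p \<noteq> q" for p q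
  proof -
    obtain x k y n where pq: "p = (x, k)" "q = (y, n)" and
      fld: "x \<in> Field r" "y \<in> Field r" "k \<in> Field s" "n \<in> Field s" and
      lex: "(k, n) \<in> s \<and> k \<noteq> n \<or> k = n \<and> (x, y) \<in> r \<and> x \<noteq> y"
      using less by (auto simp: colex_prod_def)
    \<comment> \<open>\<open>S k\<close> \<le> \<open>n\<close> by \<open>least\<close>, and
      \<open>n\<close> is strictly below \<open>S n\<close>.\<close>
    have S_mono: "(S k, S n) \<in> s \<and> S k \<noteq> S n" if "(k, n) \<in> s \<and> k \<noteq> n"
      using that least[of k n] lt[OF fld(3)] lt[OF fld(4)] Linear_order_transD[OF s]
        Linear_order_antisymD[OF s] by metis
    have n_S: "(k, S n) \<in> s \<and> k \<noteq> S n" if "(k, n) \<in> s"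
      using that lt[OF fld(4)] Linear_order_transD[OF s] Linear_order_antisymD[OF s] by metis
    have F_inj: "x \<in> L1 \<Longrightarrow> y \<in> L1 \<Longrightarrow> F1 x = F1 y \<longleftrightarrow> x = y"
       "x \<in> L2 \<Longrightarrow> y \<in> L2 \<Longrightarrow> F2 x = F2 y \<longleftrightarrow> x = y"
      using F by (auto simp: bij_betw_def inj_on_eq_iff)
    consider (11) "x \<in> L1" "y \<in> L1" | (12) "x \<in> L1" "y \<in> L2"
      | (21) "x \<in> L2" "y \<in> L1" | (22) "x \<in> L2" "y \<in> L2"
      using fld(1,2) Fld(1) by blast
    then show ?thesis
    proof cases
      case 11
      then show ?thesis
        using lex fld in_F F_inj m(1)[of x y] by (auto simp: pq g1 colex_prod_def)
    next
      \<comment> \<open>Only \<open>y\<close> moves to the next copy, so even \<open>k = n\<close>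
        leads to strictly increasing second coordinates.\<close>
      case 12
      have "(k, n) \<in> s"
        using lex fld(3) Linear_order_reflD[OF s] by blast
      then show ?thesis
        using n_S 12 fld in_F SF by (auto simp: pq g1 g2 colex_prod_def)
    next
      \<comment> \<open>The critical case: \<open>x\<close> moves up one copy while \<open>y\<close>
        stays. As \<open>L1\<close> is an initial segment, \<open>x\<close> is not below
        \<open>y\<close>, so \<open>k\<close> is strictly below \<open>n\<close> and
        \<open>S k\<close> \<le> \<open>n\<close>. If \<open>S k = n\<close>, both images lie in the
        same copy, and there \<open>L2'\<close> precedes \<open>L1'\<close>.\<close>
      case 21
      then have kn: "(k, n) \<in> s" "k \<noteq> n"
        using lex D(4,5) by blast+
      have "(F2 x, F1 y) \<in> r \<and> F2 x \<noteq> F1 y"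
        using ord_partition_less[OF r L'] FL FL2 21 by blast
      then show ?thesis
        using 21 fld in_F SF least[OF kn] by (auto simp: pq g1 g2 colex_prod_def)
    next
      case 22
      then show ?thesis
        using lex fld in_F SF F_inj m(2)[of x y] S_mono by (auto simp: pq g2 colex_prod_def)
    qed
  qed
  have "iso (colex_prod r s) (colex_prod r s) g"
    using mono im Linear_order_colex_prod[OF r s]
    by (intro Linear_order_isoI) (auto simp: Field_colex_prod_Linear_order[OF r s])
  then show thesis
    using that g1[OF a(1)] a(2) by blast
qed

section \<open>Cyclic transitivity of the product\<close>

lemma cyclically_transitive_colex_prod:
  assumes r: "Linear_order r" "cyclically_transitive r"
    and s: "Linear_order s" "discrete_order s" "unbounded_order s" "cyclically_transitive s"
  shows "cyclically_transitive (colex_prod r s)"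
  unfolding cyclically_transitive_iff
proof (intro allI impI)
  fix p q assume "(p, q) \<in> colex_prod r s"
  then obtain a b a' b' where pq: "p = (a, b)" "q = (a', b')"
    and fld: "a \<in> Field r" "a' \<in> Field r" "b' \<in> Field s" and "(b, b') \<in> s"
    using Linear_order_reflD[OF s(1)] by (auto simp: colex_prod_def)
  then have shift: "cyclic_shift (colex_prod r s) (a, b) (a, b')"
    using s(4) by (intro cyclic_shift_colex_prod[OF r(1) s(1)]) (auto simp: cyclically_transitive_iff)
  \<comment> \<open>When \<open>b\<close> is strictly below \<open>b'\<close>, the points
    \<open>a\<close> and \<open>a'\<close> may be in either order, while the hypothesis on
    \<open>r\<close> only moves points upwards. An automorphism can be inverted, which settles the
    remaining case.\<close>
  have "\<exists>g. iso (colex_prod r s) (colex_prod r s) g \<and> g (a, b') = (a', b')"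
  proof (cases "(a, a') \<in> r")
    case True
    then have "cyclic_shift r a a'"
      using r(2) by (simp add: cyclically_transitive_iff)
    then show ?thesis
      by (metis colex_prod_automorphism[OF r(1) s(1-3)])
  next
    case False
    then have "cyclic_shift r a' a"
      using r fld Linear_order_totalD[OF r(1), of a a'] by (simp add: cyclically_transitive_iff)
    then obtain g where g: "iso (colex_prod r s) (colex_prod r s) g" "g (a', b') = (a, b')"
      by (metis colex_prod_automorphism[OF r(1) s(1-3)])
    have "inj_on g (Field (colex_prod r s))"
      using g(1) by (auto simp: iso_iff2 bij_betw_def)
    then have "inv_into (Field (colex_prod r s)) g (a, b') = (a', b')"
      using g(2) fld by (intro inv_into_f_eq) (auto simp: Field_colex_prod_Linear_order[OF r(1) s(1)])
    then show ?thesis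
      using iso_inv_into_Field[OF g(1)] by blast
  qed
  then show "cyclic_shift (colex_prod r s) p q"
    using cyclic_shift_automorphism[OF Linear_order_colex_prod[OF r(1) s(1)] shift] pq by metis
qed

section \<open>Unboundedness and discreteness of the product\<close>

lemma unbounded_order_colex_prod:
  assumes "Linear_order r" "Linear_order s" "unbounded_order s"
  shows "unbounded_order (colex_prod r s)"
  unfolding unbounded_order_def
proof
  fix p assume "p \<in> Field (colex_prod r s)"
  then obtain a m where p: "p = (a, m)" "a \<in> Field r" "m \<in> Field s"
    by (auto simp: Field_colex_prod_Linear_order[OF assms(1,2)])
  obtain k n where "(k, m) \<in> s - Id" "(m, n) \<in> s - Id"
    using assms(3) p(3) unfolding unbounded_order_def by blast
  then have "((a, k), p) \<in> colex_prod r s - Id \<and> (p, (a, n)) \<in> colex_prod r s - Id"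
    using p by (auto simp: colex_prod_def intro: FieldI1 FieldI2)
  then show "\<exists>b c. (b, p) \<in> colex_prod r s - Id \<and> (p, c) \<in> colex_prod r s - Id"
    by blast
qed

text \<open>By antisymmetry of \<open>s\<close>, anything between the two points also has second
  coordinate \<open>m\<close>, so its first coordinate would lie strictly between \<open>x\<close>
  and \<open>y\<close>.\<close>

lemma immediate_succ_colex_prod:
  assumes s: "Linear_order s" and "immediate_succ r x y" "m \<in> Field s"
  shows "immediate_succ (colex_prod r s) (x, m) (y, m)"
  using assms(2,3) Linear_order_antisymD[OF s]
  by (auto simp: immediate_succ_def colex_prod_def intro: FieldI1 FieldI2)

text \<open>Since \<open>r\<close> has neither a least nor a greatest element, every point finds
  both immediate neighbours inside its own copy of \<open>r\<close>.\<close>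

lemma discrete_order_colex_prod:
  assumes r: "Linear_order r" "discrete_order r" "unbounded_order r" and s: "Linear_order s"
  shows "discrete_order (colex_prod r s)"
proof -
  have "\<exists>q. immediate_succ (colex_prod r s) p q" "\<exists>q. immediate_succ (colex_prod r s) q p"
    if "p \<in> Field (colex_prod r s)" for p
  proof -
    obtain x m where p: "p = (x, m)" "x \<in> Field r" "m \<in> Field s"
      using \<open>p \<in> _\<close> by (auto simp: Field_colex_prod_Linear_order[OF r(1) s])
    obtain b c where "immediate_succ r x b" "immediate_succ r c x"
      using discrete_unbounded_immediate[OF r p(2)] by blast
    then show "\<exists>q. immediate_succ (colex_prod r s) p q" "\<exists>q. immediate_succ (colex_prod r s) q p"
      unfolding p(1) by (blast intro: immediate_succ_colex_prod[OF s _ p(3)])+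
  qed
  then show ?thesis
    by (simp add: discrete_order_def)
qed

theorem theorem4p13:
  fixes L :: "'a rel" and M :: "'b rel"
  shows
    "(Linear_order L \<and> cyclically_transitive L \<and>
      Linear_order M \<and> discrete_order M \<and> unbounded_order M \<and> cyclically_transitive M \<longrightarrow>
        Linear_order (colex_prod L M) \<and> unbounded_order (colex_prod L M) \<and>
        cyclically_transitive (colex_prod L M)) \<and>
     (Linear_order L \<and> discrete_order L \<and> unbounded_order L \<and> cyclically_transitive L \<and>
      Linear_order M \<and> discrete_order M \<and> unbounded_order M \<and> cyclically_transitive M \<longrightarrow>
        Linear_order (colex_prod L M) \<and> discrete_order (colex_prod L M) \<and>
        unbounded_order (colex_prod L M) \<and> cyclically_transitive (colex_prod L M))"
  by (simp add: Linear_order_colex_prod unbounded_order_colex_prod discrete_order_colex_prod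
      cyclically_transitive_colex_prod)

end
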